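(* The random variable $X$ has a Lebesgue density $f$ satisfying $f(t)=0$ for $t<0$ or $t>1$, and, for $t\in[0,1]$, $$f(t)=2\int_{p_t}^{t}g(x,t)f(x)\,\mathrm{d}x+\int_t^1\bigl(g(x,t)-1\bigr)f(x)\,\mathrm{d}x,$$ where $p_t:=2\sqrt{t}-1$ and, for $x\in[0,1]$ and $t<\left(\frac{1+x}{2}\right)^2$, $$g(x,t):=\frac{1+x}{\sqrt{(1+x)^2-4t}}.$$
   Context: The law of $X$ is the unique probability distribution on $\mathbb{R}$ such that $X\stackrel{d}{=}\sqrt{U}X+\sqrt{U}(1-\sqrt{U})$, with $X$ and $U$ independent on the right-hand side and $U$ uniform on $[0,1]$. When $p_t<0$, the integrand $g(x,t)f(x)$ is taken to be $0$ for $x<0$ (where $f$ vanishes). *)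

theory Defs
  imports "HOL-Probability.Probability"
begin

text \<open>
  The equation \<open>X =\<^sub>d sqrt U * X + sqrt U * (1 - sqrt U)\<close>, with \<open>X\<close> and \<open>U\<close> independent on the
  right-hand side and \<open>U\<close> uniform on \<open>[0,1]\<close>, is a property of the law \<open>\<mu>\<close> of \<open>X\<close> only; the
  independence is the product measure.
\<close>

definition fixed_point_law :: "real measure \<Rightarrow> bool" where
  "fixed_point_law \<mu> \<longleftrightarrow> real_distribution \<mu> \<and>
     \<mu> = distr (\<mu> \<Otimes>\<^sub>M uniform_measure lborel {0..1::real}) borel
           (\<lambda>(x, u). sqrt u * x + sqrt u * (1 - sqrt u))"

definition p :: "real \<Rightarrow> real" where
  "p t = 2 * sqrt t - 1"

text \<open>
  Only the values for \<open>0 \<le> x \<le> 1\<close> and \<open>t < ((1 + x) / 2)\<^sup>2\<close>, that is \<open>p t < x\<close> when \<open>t \<ge> 0\<close>,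
  are meaningful; elsewhere \<open>g\<close> takes the junk values of the total operations.
\<close>

definition g :: "real \<Rightarrow> real \<Rightarrow> real" where
  "g x t = (1 + x) / sqrt ((1 + x)\<^sup>2 - 4 * t)"

end

theory Submission
  imports Defs
begin

text \<open>
  Substituting \<open>s = sqrt u\<close> and then \<open>t = s * (1 + x) - s\<^sup>2\<close> on the two branches \<open>s \<le> (1 + x) / 2\<close> and
  \<open>s \<ge> (1 + x) / 2\<close> shows that \<open>sqrt U * x + sqrt U * (1 - sqrt U)\<close> has an explicit density \<open>k(x, \<cdot>)\<close>
  for each \<open>x \<in> [0,1]\<close>, and a contraction argument shows that a fixed point \<open>\<mu>\<close> lives on \<open>[0,1]\<close>.
  Hence \<open>\<mu>\<close> has the density \<open>f(t) = \<integral> k(x,t) \<mu>(dx)\<close>, and feeding this back in gives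
  \<open>f(t) = \<integral> k(x,t) f(x) dx\<close> at every \<open>t\<close>, not just almost everywhere. It remains to see that \<open>f\<close> is finite
  everywhere: \<open>k(x,t)\<close> is at most a constant times \<open>\<bar>x - p t\<bar>\<close> to the power \<open>-1/2\<close>, and the third iterate
  of such a kernel is bounded, so three applications of the equation suffice.
\<close>

section \<open>The transition kernel and its singularity\<close>

text \<open>The density at \<open>t\<close> of \<open>sqrt U * x + sqrt U * (1 - sqrt U)\<close>: below \<open>x\<close> only the branch with small \<open>U\<close>
  contributes (\<open>g - 1\<close>), above \<open>x\<close> the other one adds \<open>g + 1\<close>.\<close>

definition kern :: "real \<Rightarrow> real \<Rightarrow> real" where
  "kern x t = (if 0 \<le> x \<and> x \<le> 1 \<and> 0 \<le> t \<and> t \<le> 1 \<and> p t < x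
     then (if x \<le> t then 2 * g x t else g x t - 1) else 0)"

lemma borel_measurable_p [measurable]: "p \<in> borel_measurable borel"
  unfolding p_def by measurable

lemma borel_measurable_g [measurable (raw)]:
  assumes [measurable]: "a \<in> borel_measurable M" "b \<in> borel_measurable M"
  shows "(\<lambda>x. g (a x) (b x)) \<in> borel_measurable M"
  unfolding g_def by measurable

lemma borel_measurable_kern [measurable (raw)]:
  assumes [measurable]: "a \<in> borel_measurable M" "b \<in> borel_measurable M"
  shows "(\<lambda>x. kern (a x) (b x)) \<in> borel_measurable M"
  unfolding kern_def by measurable

text \<open>A difference of squares, with \<open>4 * t\<close> as the square of
  \<open>2 * sqrt t\<close>. For x \<ge> 0 the second factor is at least 1, so the singularity of
  \<open>g\<close> comes from \<open>x - p t\<close> alone and is of inverse square root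
  type.\<close>

lemma discriminant_eq:
  "0 \<le> t \<Longrightarrow> (1 + x)\<^sup>2 - 4 * t = (x - p t) * (1 + x + 2 * sqrt t)"
  by (simp add: p_def algebra_simps power2_eq_square)

lemma discriminant_pos:
  assumes "0 \<le> t" "0 \<le> x" "p t < x"
  shows "0 < (1 + x)\<^sup>2 - 4 * t"
  using assms by (simp add: discriminant_eq add_pos_nonneg)

lemma g_ge_1:
  assumes "0 \<le> t" "0 \<le> x" "p t < x"
  shows "1 \<le> g x t"
proof -
  have "sqrt ((1 + x)\<^sup>2 - 4 * t) \<le> 1 + x"
    using assms by (intro real_le_lsqrt) auto
  then show ?thesis
    using discriminant_pos[OF assms] by (simp add: g_def)
qed

lemma kern_nonneg: "0 \<le> kern x t"
  using g_ge_1[of t x] by (auto simp: kern_def)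

text \<open>The right-hand bound is the maximum over s of \<open>s * (1 + x) - s\<^sup>2\<close>:
  the cutoff in \<open>kern\<close> expresses that t lies strictly below the top of this
  parabola.\<close>

lemma p_less_iff:
  assumes "0 \<le> t" "0 \<le> x"
  shows "p t < x \<longleftrightarrow> t < ((1 + x) / 2)\<^sup>2"
proof -
  have "p t < x \<longleftrightarrow> sqrt t < (1 + x) / 2"
    by (auto simp: p_def)
  also have "\<dots> \<longleftrightarrow> t < ((1 + x) / 2)\<^sup>2"
    using assms by (metis abs_of_nonneg add_nonneg_nonneg divide_nonneg_pos real_sqrt_abs real_sqrt_less_iff zero_le_one zero_less_numeral)
  finally show ?thesis .
qed

section \<open>The law of \<open>sqrt U * x + sqrt U * (1 - sqrt U)\<close> for fixed x\<close>

lemma nn_integral_uniform_sqrt: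
  fixes k :: "real \<Rightarrow> real"
  assumes [measurable]: "k \<in> borel_measurable borel"
  shows "(\<integral>\<^sup>+u. ennreal (k (sqrt u)) \<partial>uniform_measure lborel {0..1})
    = (\<integral>\<^sup>+s. ennreal (k s * (2 * s) * indicator {0..1} s) \<partial>lborel)"
proof -
  have "(\<integral>\<^sup>+u. ennreal (k (sqrt u)) \<partial>uniform_measure lborel {0..1})
      = (\<integral>\<^sup>+u. ennreal (k (sqrt u) * indicator {0\<^sup>2..1\<^sup>2} u) \<partial>lborel)"
    by (subst nn_integral_uniform_measure)
      (auto intro!: nn_integral_cong simp: divide_ennreal_def split: split_indicator)
  also have "\<dots> = (\<integral>\<^sup>+s. ennreal (k (sqrt (s\<^sup>2)) * (2 * s) * indicator {0..1} s) \<partial>lborel)"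
    by (rule nn_integral_substitution)
      (auto intro!: derivative_eq_intros continuous_intros simp: set_borel_measurable_def)
  also have "\<dots> = (\<integral>\<^sup>+s. ennreal (k s * (2 * s) * indicator {0..1} s) \<partial>lborel)"
    by (intro nn_integral_cong) (auto split: split_indicator)
  finally show ?thesis .
qed

text \<open>The substitution \<open>t = s * (1 + x) - s\<^sup>2\<close> on the increasing branch,
  turning the weight \<open>w\<close> in s into the weight \<open>k\<close> in t. The derivative
  \<open>1 + x - 2 * s\<close> vanishes at the upper end, where \<open>k\<close> may be singular; so
  \<open>k\<close> is tied to \<open>w\<close> only strictly below that end, which is a null
  set.\<close>

lemma nn_integral_branch:
  fixes h k :: "real \<Rightarrow> real"
  assumes [measurable]: "h \<in> borel_measurable borel" "k \<in> borel_measurable borel"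
    and a: "0 \<le> a" "a \<le> (1 + x) / 2"
    and k: "\<And>s. a \<le> s \<Longrightarrow> s < (1 + x) / 2 \<Longrightarrow> k (s * (1 + x) - s\<^sup>2) * (1 + x - 2 * s) = w s"
  shows "(\<integral>\<^sup>+s. ennreal (h (s * (1 + x) - s\<^sup>2) * w s * indicator {a..(1 + x) / 2} s) \<partial>lborel)
    = (\<integral>\<^sup>+t. ennreal (h t * k t * indicator {a * (1 + x) - a\<^sup>2..((1 + x) / 2)\<^sup>2} t) \<partial>lborel)"
proof -
  have top: "((1 + x) / 2)\<^sup>2 = (1 + x) / 2 * (1 + x) - ((1 + x) / 2)\<^sup>2"
    by (simp add: power2_eq_square field_simps)
  have "(\<integral>\<^sup>+t. ennreal (h t * k t * indicator {a * (1 + x) - a\<^sup>2..((1 + x) / 2)\<^sup>2} t) \<partial>lborel)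
      = (\<integral>\<^sup>+t. ennreal (h t * k t * indicator {a * (1 + x) - a\<^sup>2..(1 + x) / 2 * (1 + x) - ((1 + x) / 2)\<^sup>2} t) \<partial>lborel)"
    by (simp only: top[symmetric])
  also have "\<dots> = (\<integral>\<^sup>+s. ennreal (h (s * (1 + x) - s\<^sup>2) * k (s * (1 + x) - s\<^sup>2)
      * (1 + x - 2 * s) * indicator {a..(1 + x) / 2} s) \<partial>lborel)"
    using a by (intro nn_integral_substitution)
      (auto intro!: derivative_eq_intros continuous_intros simp: set_borel_measurable_def)
  also have "\<dots> = (\<integral>\<^sup>+s. ennreal (h (s * (1 + x) - s\<^sup>2) * w s * indicator {a..(1 + x) / 2} s) \<partial>lborel)"
    using AE_lborel_singleton[of "(1 + x) / 2"] k
    by (intro nn_integral_cong_AE) (auto elim!: eventually_mono simp: mult.assoc split: split_indicator)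
  finally show ?thesis ..
qed

text \<open>The discriminant of the quadratic equation \<open>s * (1 + x) - s\<^sup>2 = t\<close> in
  s is the square of the derivative of the branch, so \<open>g\<close> is \<open>1 + x\<close> over
  the Jacobian.\<close>

lemma g_branch:
  assumes "s < (1 + x) / 2"
  shows "g x (s * (1 + x) - s\<^sup>2) = (1 + x) / (1 + x - 2 * s)"
proof -
  have "(1 + x)\<^sup>2 - 4 * (s * (1 + x) - s\<^sup>2) = (1 + x - 2 * s)\<^sup>2"
    by (simp add: power2_eq_square algebra_simps)
  with assms show ?thesis by (simp add: g_def)
qed

lemma nn_integral_kern:
  fixes h :: "real \<Rightarrow> real"
  assumes h [measurable]: "h \<in> borel_measurable borel" and h_nonneg: "\<And>t. 0 \<le> h t"
    and x: "0 \<le> x" "x \<le> 1"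
  shows "(\<integral>\<^sup>+u. ennreal (h (sqrt u * x + sqrt u * (1 - sqrt u))) \<partial>uniform_measure lborel {0..1})
    = (\<integral>\<^sup>+t. ennreal (h t * kern x t) \<partial>lborel)"
proof -
  define m where "m = (1 + x) / 2"
  define T where "T s = s * (1 + x) - s\<^sup>2" for s
  have [measurable]: "T \<in> borel_measurable borel"
    unfolding T_def by measurable
  have m: "x \<le> m" "0 \<le> m" "m \<le> 1" "x \<le> m\<^sup>2"
  proof -
    have "x \<le> m\<^sup>2 \<longleftrightarrow> 0 \<le> (1 - x)\<^sup>2" by (simp add: m_def power2_eq_square field_simps)
    then show "x \<le> m\<^sup>2" by simp
  qed (use x in \<open>auto simp: m_def\<close>)
  have Teq: "sqrt u * x + sqrt u * (1 - sqrt u) = T (sqrt u)" for u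
    by (simp add: T_def algebra_simps power2_eq_square)
  have "(\<integral>\<^sup>+u. ennreal (h (sqrt u * x + sqrt u * (1 - sqrt u))) \<partial>uniform_measure lborel {0..1})
      = (\<integral>\<^sup>+s. ennreal (h (T s) * (2 * s) * indicator {0..1} s) \<partial>lborel)"
    unfolding Teq using nn_integral_uniform_sqrt[of "\<lambda>s. h (T s)"] by simp
  also have "\<dots> = (\<integral>\<^sup>+s. ennreal (h (T s) * (2 * s) * indicator {0..m} s)
      + ennreal (h (T s) * (2 * s) * indicator {m..1} s) \<partial>lborel)"
    using AE_lborel_singleton[of m] m
    by (intro nn_integral_cong_AE) (auto elim!: eventually_mono split: split_indicator)
  also have "\<dots> = (\<integral>\<^sup>+s. ennreal (h (T s) * (2 * s) * indicator {0..m} s) \<partial>lborel)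
      + (\<integral>\<^sup>+s. ennreal (h (T s) * (2 * s) * indicator {m..1} s) \<partial>lborel)"
    by (rule nn_integral_add) auto
  \<comment> \<open>The reflection of s to \<open>1 + x - s\<close> preserves \<open>T\<close> and
    carries the decreasing branch to the part [x, m] of the increasing one, so
    \<open>nn_integral_branch\<close> serves both.\<close>
  also have "(\<integral>\<^sup>+s. ennreal (h (T s) * (2 * s) * indicator {m..1} s) \<partial>lborel)
      = (\<integral>\<^sup>+s. ennreal (h (T s) * (2 * (1 + x - s)) * indicator {x..m} s) \<partial>lborel)"
  proof -
    have "T (1 + x - s) = T s" for s
      by (simp add: T_def power2_eq_square algebra_simps)
    moreover have "indicator {m..1} (1 + x - s) = (indicator {x..m} s :: real)" for s
      by (auto simp: m_def indicator_def field_simps)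
    ultimately show ?thesis
      by (subst nn_integral_real_affine[where c = "-1" and t = "1 + x"]) auto
  qed
  \<comment> \<open>Dividing the weight \<open>2 * (1 + x - s)\<close> by the Jacobian gives
    \<open>g x t + 1\<close>; below, \<open>2 * s\<close> gives \<open>g x t - 1\<close>. Where both
    branches contribute, the sum is \<open>2 * g x t\<close>.\<close>
  also have "\<dots> = (\<integral>\<^sup>+t. ennreal (h t * (g x t + 1) * indicator {x..m\<^sup>2} t) \<partial>lborel)"
    unfolding T_def m_def
  proof (subst nn_integral_branch[where k = "\<lambda>t. g x t + 1"])
    fix s assume "s < (1 + x) / 2"
    then show "(g x (s * (1 + x) - s\<^sup>2) + 1) * (1 + x - 2 * s) = 2 * (1 + x - s)"
      by (subst g_branch) (auto simp: field_simps)
  qed (use x in \<open>auto simp: algebra_simps power2_eq_square\<close>)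
  also have "(\<integral>\<^sup>+s. ennreal (h (T s) * (2 * s) * indicator {0..m} s) \<partial>lborel)
      = (\<integral>\<^sup>+t. ennreal (h t * (g x t - 1) * indicator {0..m\<^sup>2} t) \<partial>lborel)"
    unfolding T_def m_def
  proof (subst nn_integral_branch[where k = "\<lambda>t. g x t - 1"])
    fix s assume "s < (1 + x) / 2"
    then show "(g x (s * (1 + x) - s\<^sup>2) - 1) * (1 + x - 2 * s) = 2 * s"
      by (subst g_branch) (auto simp: field_simps)
  qed (use x in auto)
  also have "(\<integral>\<^sup>+t. ennreal (h t * (g x t - 1) * indicator {0..m\<^sup>2} t) \<partial>lborel)
      + (\<integral>\<^sup>+t. ennreal (h t * (g x t + 1) * indicator {x..m\<^sup>2} t) \<partial>lborel)
      = (\<integral>\<^sup>+t. ennreal (h t * (g x t - 1) * indicator {0..m\<^sup>2} t)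
          + ennreal (h t * (g x t + 1) * indicator {x..m\<^sup>2} t) \<partial>lborel)"
    by (rule nn_integral_add[symmetric]) auto
  also have "\<dots> = (\<integral>\<^sup>+t. ennreal (h t * kern x t) \<partial>lborel)"
  proof (rule nn_integral_cong_AE, rule eventually_mono[OF AE_lborel_singleton[of "m\<^sup>2"]])
    \<comment> \<open>At \<open>t = m\<^sup>2\<close> the two sides can differ: \<open>kern\<close>
      is cut off there, while \<open>g\<close> has the value 0 of a division by 0.\<close>
    fix t assume "t \<noteq> m\<^sup>2"
    have m1: "m\<^sup>2 \<le> 1" using m by (simp add: power_le_one)
    consider "t < 0 \<or> t > m\<^sup>2" | "0 \<le> t" "t < m\<^sup>2" using \<open>t \<noteq> m\<^sup>2\<close> by linarith
    then show "ennreal (h t * (g x t - 1) * indicator {0..m\<^sup>2} t)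
        + ennreal (h t * (g x t + 1) * indicator {x..m\<^sup>2} t) = ennreal (h t * kern x t)"
    proof cases
      case 1
      then have "kern x t = 0"
        using p_less_iff[of t x] x by (auto simp: kern_def m_def)
      with 1 x show ?thesis by auto
    next
      case 2
      then have "p t < x"
        using p_less_iff[of t x] x by (auto simp: m_def)
      moreover from 2 this have "1 \<le> g x t" using g_ge_1 x by simp
      moreover have "0 \<le> h t * (g x t - 1)" "0 \<le> h t * (g x t + 1)"
        using h_nonneg[of t] \<open>1 \<le> g x t\<close> by auto
      ultimately show ?thesis
        using 2 x m1
        by (auto simp: kern_def ennreal_plus[symmetric] simp del: ennreal_plus split: split_indicator)
          (simp add: algebra_simps)
    qed
  qed
  finally show ?thesis .
qed

section \<open>The support of a fixed point\<close>

lemma fixed_point_nn_integral: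
  assumes "fixed_point_law \<mu>" and [measurable]: "k \<in> borel_measurable borel"
  shows "(\<integral>\<^sup>+x. k x \<partial>\<mu>)
    = (\<integral>\<^sup>+x. \<integral>\<^sup>+u. k (sqrt u * x + sqrt u * (1 - sqrt u)) \<partial>uniform_measure lborel {0..1} \<partial>\<mu>)"
proof -
  interpret real_distribution \<mu> using assms by (simp add: fixed_point_law_def)
  interpret U: prob_space "uniform_measure lborel {0..1::real}"
    by (rule prob_space_uniform_measure) auto
  have "(\<integral>\<^sup>+x. k x \<partial>\<mu>) = (\<integral>\<^sup>+x. k x \<partial>distr (\<mu> \<Otimes>\<^sub>M uniform_measure lborel {0..1::real}) borel
           (\<lambda>(x, u). sqrt u * x + sqrt u * (1 - sqrt u)))"
    by (rule arg_cong[where f = "\<lambda>\<nu>. integral\<^sup>N \<nu> k"]) (use assms(1) in \<open>simp only: fixed_point_law_def\<close>)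
  also have "\<dots> = (\<integral>\<^sup>+z. k (case z of (x, u) \<Rightarrow> sqrt u * x + sqrt u * (1 - sqrt u))
      \<partial>(\<mu> \<Otimes>\<^sub>M uniform_measure lborel {0..1::real}))"
    by (rule nn_integral_distr) auto
  also have "\<dots> = (\<integral>\<^sup>+x. \<integral>\<^sup>+u. k (sqrt u * x + sqrt u * (1 - sqrt u)) \<partial>uniform_measure lborel {0..1} \<partial>\<mu>)"
    by (subst U.nn_integral_fst[symmetric]) auto
  finally show ?thesis .
qed

text \<open>Passing from \<open>X\<close> to \<open>sqrt U * X + sqrt U * (1 - sqrt U)\<close> can only increase \<open>exp (- \<phi>)\<close>, strictly so where
  \<open>\<phi> > 0\<close>; the bounded function \<open>exp (- \<phi>)\<close> makes the two expectations finite, and they agree.\<close>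

lemma fixed_point_contracted_AE_zero:
  assumes \<mu>: "fixed_point_law \<mu>"
    and [measurable]: "\<phi> \<in> borel_measurable borel" and nonneg: "\<And>x. 0 \<le> \<phi> x"
    and contr: "\<And>s x. 0 \<le> s \<Longrightarrow> s \<le> 1 \<Longrightarrow> \<phi> (s * x + s * (1 - s)) \<le> s * \<phi> x"
  shows "AE x in \<mu>. \<phi> x = 0"
proof -
  interpret real_distribution \<mu> using \<mu> by (simp add: fixed_point_law_def)
  let ?U = "uniform_measure lborel {0..1::real}"
  interpret U: prob_space ?U
    by (rule prob_space_uniform_measure) auto
  define e where "e x = ennreal (exp (- \<phi> x))" for x
  have [measurable]: "e \<in> borel_measurable borel" unfolding e_def by measurable
  have e1: "e x \<le> 1" for x
    using nonneg[of x] by (simp add: e_def flip: ennreal_1)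
  define E where "E x = (\<integral>\<^sup>+u. e (sqrt u * x + sqrt u * (1 - sqrt u)) \<partial>?U)" for x
  have [measurable]: "E \<in> borel_measurable borel" unfolding E_def by measurable
  have U01: "AE u in ?U. 0 < u \<and> u < 1"
    by (rule AE_uniform_measureI)
      (auto intro!: eventually_mono[OF eventually_conj[OF AE_lborel_singleton[of 0] AE_lborel_singleton[of 1]]])
  have le: "AE u in ?U. e x \<le> e (sqrt u * x + sqrt u * (1 - sqrt u))" for x
    using U01
  proof eventually_elim
    case (elim u)
    then have "\<phi> (sqrt u * x + sqrt u * (1 - sqrt u)) \<le> sqrt u * \<phi> x" by (intro contr) auto
    also have "\<dots> \<le> 1 * \<phi> x" using elim nonneg by (intro mult_right_mono) auto
    finally show ?case by (simp add: e_def)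
  qed
  have const: "(\<integral>\<^sup>+u. e x \<partial>?U) = e x" for x by (simp add: U.emeasure_space_1)
  have eE: "e x \<le> E x" for x
    unfolding E_def by (subst const[symmetric], rule nn_integral_mono_AE, rule le)
  have fin: "(\<integral>\<^sup>+x. e x \<partial>\<mu>) \<noteq> \<infinity>"
  proof -
    have "(\<integral>\<^sup>+x. e x \<partial>\<mu>) \<le> (\<integral>\<^sup>+x. 1 \<partial>\<mu>)" by (intro nn_integral_mono e1)
    also have "\<dots> = 1" by (simp add: emeasure_space_1[unfolded space_eq_univ])
    finally show ?thesis by (auto simp: top_unique)
  qed
  \<comment> \<open>The nonnegative gap \<open>E x - e x\<close> has integral zero, because the
    fixed-point equation gives \<open>E\<close> and \<open>e\<close> the same finite
    integral.\<close>
  have "(\<integral>\<^sup>+x. E x - e x \<partial>\<mu>) = (\<integral>\<^sup>+x. E x \<partial>\<mu>) - (\<integral>\<^sup>+x. e x \<partial>\<mu>)"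
    using fin eE by (intro nn_integral_diff) auto
  also have "(\<integral>\<^sup>+x. E x \<partial>\<mu>) = (\<integral>\<^sup>+x. e x \<partial>\<mu>)"
    unfolding E_def by (rule fixed_point_nn_integral[OF \<mu>, symmetric]) measurable
  finally have "(\<integral>\<^sup>+x. E x - e x \<partial>\<mu>) = 0"
    using fin by simp
  then have "AE x in \<mu>. E x - e x = 0"
    by (subst (asm) nn_integral_0_iff_AE) auto
  then show ?thesis
  proof eventually_elim
    case (elim x)
    \<comment> \<open>For such x the inequality \<open>le\<close> must be an equality for almost
      every u; combined with \<open>contr\<close> and \<open>sqrt u < 1\<close> this forces
      \<open>\<phi> x = 0\<close>.\<close>
    have "(\<integral>\<^sup>+u. e (sqrt u * x + sqrt u * (1 - sqrt u)) - e x \<partial>?U) = E x - (\<integral>\<^sup>+u. e x \<partial>?U)"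
      unfolding E_def using le by (intro nn_integral_diff) (auto simp: const e_def)
    also have "\<dots> = 0" using elim by (simp only: const)
    finally have "AE u in ?U. e (sqrt u * x + sqrt u * (1 - sqrt u)) - e x = 0"
      by (subst (asm) nn_integral_0_iff_AE) auto
    with U01 have "AE u in ?U. \<phi> x = 0"
    proof eventually_elim
      case (elim u)
      then have "\<phi> x \<le> \<phi> (sqrt u * x + sqrt u * (1 - sqrt u))"
        by (simp add: diff_eq_0_iff_ennreal e_def)
      also have "\<dots> \<le> sqrt u * \<phi> x" using elim by (intro contr) auto
      finally have "\<phi> x * (1 - sqrt u) \<le> 0" by (simp add: algebra_simps)
      moreover have "0 < 1 - sqrt u" using elim by simp
      ultimately show ?case using nonneg[of x] by (simp add: mult_le_0_iff)
    qed
    then show ?case by simp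
  qed
qed

text \<open>The distances by which x lies below 0 and above 1 both shrink by the factor s: the added
  term \<open>s * (1 - s)\<close> is nonnegative, and measured from 1 the map is
  \<open>s * (x - 1)\<close> minus the square of \<open>1 - s\<close>.\<close>

lemma fixed_point_AE_01:
  assumes "fixed_point_law \<mu>"
  shows "AE x in \<mu>. 0 \<le> x \<and> x \<le> 1"
proof -
  have "AE x in \<mu>. max (- x) 0 = 0"
  proof (rule fixed_point_contracted_AE_zero[OF assms])
    fix s x :: real assume s: "0 \<le> s" "s \<le> 1"
    have "s * (- x) \<le> s * max (- x) 0"
      using s(1) by (intro mult_left_mono) auto
    moreover have "0 \<le> s * (1 - s)" "0 \<le> s * max (- x) 0"
      using s by simp_all
    ultimately show "max (- (s * x + s * (1 - s))) 0 \<le> s * max (- x) 0"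
      by simp
  qed auto
  moreover have "AE x in \<mu>. max (x - 1) 0 = 0"
  proof (rule fixed_point_contracted_AE_zero[OF assms])
    fix s x :: real assume s: "0 \<le> s" "s \<le> 1"
    have "s * x + s * (1 - s) - 1 = s * (x - 1) - (1 - s)\<^sup>2"
      by (simp add: power2_eq_square algebra_simps)
    moreover have "s * (x - 1) \<le> s * max (x - 1) 0" "0 \<le> s * max (x - 1) 0"
      using s by (auto intro!: mult_left_mono mult_nonneg_nonneg)
    moreover have "0 \<le> (1 - s)\<^sup>2" by simp
    ultimately show "max (s * x + s * (1 - s) - 1) 0 \<le> s * max (x - 1) 0"
      by linarith
  qed auto
  ultimately show ?thesis by eventually_elim auto
qed

section \<open>Bounds for the singular kernel and finiteness of the density\<close>

text \<open>The exponent \<open>-1/4\<close> is chosen so that the square of \<open>sing\<close> dominates \<open>kern\<close> while its cube is still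
  integrable in either variable, uniformly in the other.\<close>

definition sing :: "real \<Rightarrow> real \<Rightarrow> real" where
  "sing x t = (if 0 \<le> x \<and> x \<le> 1 \<and> 0 \<le> t \<and> t \<le> 1 then \<bar>x - p t\<bar> powr (-1/4) else 0)"

lemma borel_measurable_sing [measurable (raw)]:
  assumes [measurable]: "a \<in> borel_measurable M" "b \<in> borel_measurable M"
  shows "(\<lambda>x. sing (a x) (b x)) \<in> borel_measurable M"
  unfolding sing_def by measurable

lemma sing_nonneg: "0 \<le> sing x t"
  by (simp add: sing_def)

text \<open>By \<open>discriminant_eq\<close>, \<open>g\<close> is the square of \<open>sing\<close>
  times \<open>(1 + x) / sqrt (1 + x + 2 * sqrt t)\<close>, which is at most 2; the remaining factor
  2 comes from \<open>2 * g x t\<close> in \<open>kern\<close>.\<close>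

lemma kern_le: "kern x t \<le> 4 * (sing x t)\<^sup>2"
proof (cases "0 \<le> x \<and> x \<le> 1 \<and> 0 \<le> t \<and> t \<le> 1 \<and> p t < x")
  case True
  have "(sing x t)\<^sup>2 = (x - p t) powr (-1/2)"
    using True by (simp add: sing_def power2_eq_square flip: powr_add)
  also have "\<dots> = 1 / sqrt (x - p t)"
    using True by (simp add: powr_minus_divide powr_half_sqrt)
  finally have sing: "(sing x t)\<^sup>2 = 1 / sqrt (x - p t)" .
  have "1 \<le> sqrt (1 + x + 2 * sqrt t)"
    using True by simp
  then have "(1 + x) / sqrt (1 + x + 2 * sqrt t) \<le> 2"
    using True by (subst pos_divide_le_eq) linarith+
  then have "(1 + x) / sqrt (1 + x + 2 * sqrt t) * (1 / sqrt (x - p t)) \<le> 2 * (1 / sqrt (x - p t))"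
    using True by (intro mult_right_mono) auto
  moreover have "g x t = (1 + x) / sqrt (1 + x + 2 * sqrt t) * (1 / sqrt (x - p t))"
    using True unfolding g_def by (subst discriminant_eq) (simp_all add: real_sqrt_mult)
  ultimately have "g x t \<le> 2 * (sing x t)\<^sup>2"
    by (simp only: sing)
  moreover have "kern x t \<le> 2 * g x t"
    using True g_ge_1[of t x] by (simp add: kern_def)
  ultimately show ?thesis by simp
qed (auto simp: kern_def)

text \<open>Each factor is at most the largest of the three: AM-GM without its constant 1/3.\<close>

lemma prod3_le_sum_cubes:
  fixes u v w :: real
  assumes "0 \<le> u" "0 \<le> v" "0 \<le> w"
  shows "u * v * w \<le> u ^ 3 + v ^ 3 + w ^ 3"
proof -
  have "u * v * w \<le> max u (max v w) * max u (max v w) * max u (max v w)"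
    using assms by (intro mult_mono) auto
  also have "\<dots> \<le> u ^ 3 + v ^ 3 + w ^ 3"
    using assms by (auto simp: max_def power3_eq_cube)
  finally show ?thesis .
qed

text \<open>The product of squares is regrouped as (ab)(bc)(ac), so that after cubing every summand
  has lost one of the three singular factors. The two that remain can be integrated one after the
  other over z and x. The constant is the cube of 4.\<close>

lemma kern_prod_le:
  "kern y z * kern z x * kern x t \<le> 64 * (sing y z ^ 3 * sing z x ^ 3
     + sing z x ^ 3 * sing x t ^ 3 + sing y z ^ 3 * sing x t ^ 3)"
proof -
  let ?a = "sing y z" and ?b = "sing z x" and ?c = "sing x t"
  have "kern y z * kern z x * kern x t \<le> (4 * ?a\<^sup>2) * (4 * ?b\<^sup>2) * (4 * ?c\<^sup>2)"
    by (intro mult_mono kern_le mult_nonneg_nonneg kern_nonneg) auto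
  also have "\<dots> = 64 * ((?a * ?b) * (?b * ?c) * (?a * ?c))"
    by (simp add: power2_eq_square)
  also have "\<dots> \<le> 64 * ((?a * ?b) ^ 3 + (?b * ?c) ^ 3 + (?a * ?c) ^ 3)"
    by (intro mult_left_mono prod3_le_sum_cubes mult_nonneg_nonneg sing_nonneg) auto
  finally show ?thesis by (simp add: power_mult_distrib)
qed

text \<open>For x in [0, 1] and \<open>p t\<close> in [-1, 1] the difference \<open>x - p t\<close>
  stays in [-2, 2], so this single integral dominates that of the cube of \<open>sing\<close> in
  either variable.\<close>

definition sing_mass :: ennreal where
  "sing_mass = (\<integral>\<^sup>+r. ennreal ((\<bar>r\<bar> powr (-1/4)) ^ 3 * indicator {-2..2} r) \<partial>lborel)"

text \<open>The cube has exponent -3/4, which exceeds -1.\<close>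

lemma sing_mass_finite: "sing_mass < \<infinity>"
proof -
  let ?F = "\<lambda>r::real. ennreal (r powr (-3/4)) * indicator {0..2} r"
  have cube: "(\<bar>r\<bar> powr (-1/4)) ^ 3 = \<bar>r\<bar> powr (-3/4)" for r :: real
    by (simp add: power3_eq_cube flip: powr_add)
  have "integral\<^sup>N lborel ?F = ennreal (2 powr (-3/4 + 1) / (-3/4 + 1))"
    by (intro nn_integral_has_integral_lebesgue' has_integral_powr_from_0) auto
  then have fin: "integral\<^sup>N lborel ?F < \<infinity>" by simp
  have "sing_mass \<le> (\<integral>\<^sup>+r. ?F r + ?F (-r) \<partial>lborel)"
    unfolding sing_mass_def cube
    by (intro nn_integral_mono) (auto simp: abs_if split: split_indicator)
  also have "\<dots> = integral\<^sup>N lborel ?F + (\<integral>\<^sup>+r. ?F (-r) \<partial>lborel)"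
    by (rule nn_integral_add) auto
  also have "(\<integral>\<^sup>+r. ?F (-r) \<partial>lborel) = integral\<^sup>N lborel ?F"
    by (subst (2) nn_integral_real_affine[where c = "-1" and t = 0]) auto
  also have "integral\<^sup>N lborel ?F + integral\<^sup>N lborel ?F < \<infinity>"
    using fin by (auto simp: less_top[symmetric])
  finally show ?thesis .
qed

lemma nn_integral_sing_fst: "(\<integral>\<^sup>+x. ennreal (sing x t ^ 3) \<partial>lborel) \<le> sing_mass"
proof (cases "0 \<le> t \<and> t \<le> 1")
  case True
  then have pt: "-1 \<le> p t" "p t \<le> 1" by (auto simp: p_def)
  have "(\<integral>\<^sup>+x. ennreal (sing x t ^ 3) \<partial>lborel)
      \<le> (\<integral>\<^sup>+x. ennreal ((\<bar>- p t + 1 * x\<bar> powr (-1/4)) ^ 3 * indicator {-2..2} (- p t + 1 * x)) \<partial>lborel)"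
    using True pt by (intro nn_integral_mono) (auto simp: sing_def split: split_indicator)
  also have "\<dots> = sing_mass"
    unfolding sing_mass_def by (subst (2) nn_integral_real_affine[where c = 1 and t = "- p t"]) auto
  finally show ?thesis .
next
  case False
  then have "sing x t = 0" for x by (auto simp: sing_def)
  then show ?thesis by simp
qed

text \<open>The substitution \<open>t = ((1 + q) / 2)\<^sup>2\<close> inverts \<open>p\<close>, and
  its Jacobian \<open>(1 + q) / 2\<close> is at most 1 on [-1, 1]; what is left is a function of
  \<open>x - q\<close>.\<close>

lemma nn_integral_sing_snd: "(\<integral>\<^sup>+t. ennreal (sing x t ^ 3) \<partial>lborel) \<le> sing_mass"
proof (cases "0 \<le> x \<and> x \<le> 1")
  case True
  let ?q = "\<lambda>q::real. ((1 + q) / 2)\<^sup>2"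
  have pq: "p (?q q) = q" if "-1 \<le> q" for q
  proof -
    have "sqrt (?q q) = (1 + q) / 2" using that by simp
    then show ?thesis by (simp add: p_def field_simps del: real_sqrt_abs)
  qed
  have "(\<integral>\<^sup>+t. ennreal (sing x t ^ 3) \<partial>lborel)
      = (\<integral>\<^sup>+t. ennreal ((\<bar>x - p t\<bar> powr (-1/4)) ^ 3 * indicator {?q (-1)..?q 1} t) \<partial>lborel)"
    using True by (intro nn_integral_cong) (auto simp: sing_def split: split_indicator)
  also have "\<dots> = (\<integral>\<^sup>+q. ennreal ((\<bar>x - p (?q q)\<bar> powr (-1/4)) ^ 3 * ((1 + q) / 2) * indicator {-1..1} q) \<partial>lborel)"
    by (rule nn_integral_substitution)
      (auto intro!: derivative_eq_intros continuous_intros simp: set_borel_measurable_def)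
  also have "\<dots> \<le> (\<integral>\<^sup>+q. ennreal ((\<bar>x + (-1) * q\<bar> powr (-1/4)) ^ 3 * indicator {-2..2} (x + (-1) * q)) \<partial>lborel)"
  proof (intro nn_integral_mono ennreal_leI)
    fix q :: real
    show "(\<bar>x - p (?q q)\<bar> powr (-1/4)) ^ 3 * ((1 + q) / 2) * indicator {-1..1} q
      \<le> (\<bar>x + (-1) * q\<bar> powr (-1/4)) ^ 3 * indicator {-2..2} (x + (-1) * q)"
    proof (cases "-1 \<le> q \<and> q \<le> 1")
      case q: True
      then have "(\<bar>x - q\<bar> powr (-1/4)) ^ 3 * ((1 + q) / 2) \<le> (\<bar>x - q\<bar> powr (-1/4)) ^ 3 * 1"
        by (intro mult_left_mono) auto
      with q True show ?thesis by (simp add: pq)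
    qed simp
  qed
  also have "\<dots> = sing_mass"
    unfolding sing_mass_def by (subst (2) nn_integral_real_affine[where c = "-1" and t = x]) auto
  finally show ?thesis .
next
  case False
  then have "sing x t = 0" for t by (auto simp: sing_def)
  then show ?thesis by simp
qed

lemma kern_fixed_point_finite:
  fixes F :: "real \<Rightarrow> ennreal"
  assumes "real_distribution \<mu>"
    and F: "\<And>t. F t = (\<integral>\<^sup>+x. ennreal (kern x t) \<partial>\<mu>)"
    and fixp: "\<And>t. F t = (\<integral>\<^sup>+x. F x * ennreal (kern x t) \<partial>lborel)"
  shows "F t < \<infinity>"
proof -
  interpret real_distribution \<mu> by fact
  interpret P: pair_sigma_finite \<mu> lborel ..
  have [measurable]: "F \<in> borel_measurable borel"
    unfolding F by measurable
  define s where "s x t = ennreal (sing x t ^ 3)" for x t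
  have [measurable]: "case_prod s \<in> borel_measurable (borel \<Otimes>\<^sub>M borel)"
    unfolding s_def by measurable
  have s_fst: "(\<integral>\<^sup>+x. s x t \<partial>lborel) \<le> sing_mass" and s_snd: "(\<integral>\<^sup>+t. s x t \<partial>lborel) \<le> sing_mass" for x t
    unfolding s_def by (rule nn_integral_sing_fst nn_integral_sing_snd)+
  define G where "G z = (\<integral>\<^sup>+y. s y z \<partial>\<mu>)" for z
  have [measurable]: "G \<in> borel_measurable borel" unfolding G_def by measurable
  have G: "(\<integral>\<^sup>+z. G z \<partial>lborel) \<le> sing_mass"
  proof -
    have "(\<integral>\<^sup>+z. G z \<partial>lborel) = (\<integral>\<^sup>+y. \<integral>\<^sup>+z. s y z \<partial>lborel \<partial>\<mu>)"
      unfolding G_def by (rule P.Fubini') measurable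
    also have "\<dots> \<le> (\<integral>\<^sup>+y. sing_mass \<partial>\<mu>)"
      by (intro nn_integral_mono s_snd)
    finally show ?thesis by (simp add: emeasure_space_1[unfolded space_eq_univ])
  qed
  have ks: "ennreal (kern y z) * ennreal (kern z x) * ennreal (kern x t)
    \<le> 64 * (s y z * s z x + s z x * s x t + s y z * s x t)" for x y z
  proof -
    have "ennreal (kern y z) * ennreal (kern z x) * ennreal (kern x t)
        = ennreal (kern y z * kern z x * kern x t)"
      by (simp add: ennreal_mult kern_nonneg)
    also have "\<dots> \<le> ennreal (64 * (sing y z ^ 3 * sing z x ^ 3
     + sing z x ^ 3 * sing x t ^ 3 + sing y z ^ 3 * sing x t ^ 3))"
      by (intro ennreal_leI kern_prod_le)
    also have "\<dots> = 64 * (s y z * s z x + s z x * s x t + s y z * s x t)"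
      by (simp add: s_def ennreal_mult sing_nonneg ennreal_plus)
    finally show ?thesis .
  qed
  \<comment> \<open>Two uses of \<open>fixp\<close> and one of \<open>F\<close> produce three
    kernels along y, z, x, t. The innermost integral is against the probability measure
    \<open>\<mu>\<close>, so nothing about the size of \<open>F\<close> is presupposed.\<close>
  have "F t = (\<integral>\<^sup>+x. (\<integral>\<^sup>+z. (\<integral>\<^sup>+y. ennreal (kern y z) \<partial>\<mu>) * ennreal (kern z x) \<partial>lborel) * ennreal (kern x t) \<partial>lborel)"
    by (subst fixp, subst fixp, subst F) rule
  also have "\<dots> = (\<integral>\<^sup>+x. \<integral>\<^sup>+z. \<integral>\<^sup>+y. ennreal (kern y z) * ennreal (kern z x) * ennreal (kern x t) \<partial>\<mu> \<partial>lborel \<partial>lborel)"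
    by (simp add: nn_integral_multc)
  also have "\<dots> \<le> (\<integral>\<^sup>+x. \<integral>\<^sup>+z. \<integral>\<^sup>+y. 64 * (s y z * s z x + s z x * s x t + s y z * s x t) \<partial>\<mu> \<partial>lborel \<partial>lborel)"
    by (intro nn_integral_mono ks)
  also have "\<dots> = 64 * ((\<integral>\<^sup>+x. \<integral>\<^sup>+z. G z * s z x \<partial>lborel \<partial>lborel)
      + (\<integral>\<^sup>+x. (\<integral>\<^sup>+z. s z x \<partial>lborel) * s x t \<partial>lborel)
      + (\<integral>\<^sup>+x. (\<integral>\<^sup>+z. G z \<partial>lborel) * s x t \<partial>lborel))"
    by (simp add: nn_integral_add nn_integral_cmult nn_integral_multc G_def emeasure_space_1[unfolded space_eq_univ])
  \<comment> \<open>In this term z occurs in both factors, so x is integrated first, by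
    \<open>s_snd\<close>, and then \<open>G\<close>. In the other two terms the inner z-integral is
    already at most \<open>sing_mass\<close>.\<close>
  also have "(\<integral>\<^sup>+x. \<integral>\<^sup>+z. G z * s z x \<partial>lborel \<partial>lborel) = (\<integral>\<^sup>+z. \<integral>\<^sup>+x. G z * s z x \<partial>lborel \<partial>lborel)"
    by (rule lborel_pair.Fubini') measurable
  also have "\<dots> = (\<integral>\<^sup>+z. G z * (\<integral>\<^sup>+x. s z x \<partial>lborel) \<partial>lborel)"
    by (simp add: nn_integral_cmult)
  also have "\<dots> \<le> (\<integral>\<^sup>+z. G z * sing_mass \<partial>lborel)"
    by (intro nn_integral_mono mult_left_mono s_snd) simp
  also have "\<dots> = (\<integral>\<^sup>+z. G z \<partial>lborel) * sing_mass"
    by (rule nn_integral_multc) simp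
  also have "\<dots> \<le> sing_mass * sing_mass"
    by (intro mult_right_mono G) simp
  also have "(\<integral>\<^sup>+x. (\<integral>\<^sup>+z. s z x \<partial>lborel) * s x t \<partial>lborel) \<le> (\<integral>\<^sup>+x. sing_mass * s x t \<partial>lborel)"
    by (intro nn_integral_mono mult_right_mono s_fst) simp
  also have "(\<integral>\<^sup>+x. (\<integral>\<^sup>+z. G z \<partial>lborel) * s x t \<partial>lborel) \<le> (\<integral>\<^sup>+x. sing_mass * s x t \<partial>lborel)"
    by (intro nn_integral_mono mult_right_mono G) simp
  also have "(\<integral>\<^sup>+x. sing_mass * s x t \<partial>lborel) = sing_mass * (\<integral>\<^sup>+x. s x t \<partial>lborel)"
    by (rule nn_integral_cmult) simp
  also have "\<dots> \<le> sing_mass * sing_mass"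
    by (intro mult_left_mono s_fst) simp
  finally have "F t \<le> 64 * (sing_mass * sing_mass + sing_mass * sing_mass + sing_mass * sing_mass)"
    by (simp add: add_mono mult_left_mono)
  also have "\<dots> < \<infinity>"
    using sing_mass_finite by (simp add: ennreal_mult_less_top)
  finally show ?thesis .
qed

section \<open>The density and its integral equation\<close>

text \<open>The fixed-point law is a mixture over \<open>\<mu>\<close> of laws with density
  \<open>kern x\<close>; Tonelli moves the integral over t outside.\<close>

lemma fixed_point_law_density:
  assumes "fixed_point_law \<mu>"
  shows "\<mu> = density lborel (\<lambda>t. \<integral>\<^sup>+x. ennreal (kern x t) \<partial>\<mu>)"
proof (rule measure_eqI)
  interpret real_distribution \<mu> using assms by (simp add: fixed_point_law_def)
  interpret P: pair_sigma_finite \<mu> lborel ..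
  show "sets \<mu> = sets (density lborel (\<lambda>t. \<integral>\<^sup>+x. ennreal (kern x t) \<partial>\<mu>))"
    by simp
  fix A assume "A \<in> sets \<mu>"
  then have [measurable]: "A \<in> sets borel" by simp
  have "emeasure \<mu> A = (\<integral>\<^sup>+x. ennreal (indicator A x) \<partial>\<mu>)"
    by (simp add: ennreal_indicator)
  also have "\<dots> = (\<integral>\<^sup>+x. \<integral>\<^sup>+u. ennreal (indicator A (sqrt u * x + sqrt u * (1 - sqrt u)))
      \<partial>uniform_measure lborel {0..1} \<partial>\<mu>)"
    by (rule fixed_point_nn_integral[OF assms]) measurable
  also have "\<dots> = (\<integral>\<^sup>+x. \<integral>\<^sup>+t. ennreal (indicator A t * kern x t) \<partial>lborel \<partial>\<mu>)"
    by (rule nn_integral_cong_AE, rule eventually_mono[OF fixed_point_AE_01[OF assms]])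
      (auto intro!: nn_integral_kern)
  also have "\<dots> = (\<integral>\<^sup>+t. \<integral>\<^sup>+x. ennreal (indicator A t * kern x t) \<partial>\<mu> \<partial>lborel)"
    by (rule P.Fubini'[symmetric]) measurable
  also have "\<dots> = (\<integral>\<^sup>+t. (\<integral>\<^sup>+x. ennreal (kern x t) \<partial>\<mu>) * indicator A t \<partial>lborel)"
    by (intro nn_integral_cong) (simp split: split_indicator)
  also have "\<dots> = emeasure (density lborel (\<lambda>t. \<integral>\<^sup>+x. ennreal (kern x t) \<partial>\<mu>)) A"
    by (rule emeasure_density[symmetric]) auto
  finally show "emeasure \<mu> A = emeasure (density lborel (\<lambda>t. \<integral>\<^sup>+x. ennreal (kern x t) \<partial>\<mu>)) A" .
qed

lemma p_le: "0 \<le> t \<Longrightarrow> p t \<le> t"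
proof -
  assume "0 \<le> t"
  then have "t - p t = (1 - sqrt t)\<^sup>2" by (simp add: p_def power2_diff)
  then show ?thesis by (metis diff_ge_0_iff_ge zero_le_power2)
qed

text \<open>The integral is cut at \<open>x = t\<close>, where \<open>kern\<close> changes its
  formula. If \<open>p t < 0\<close>, the junk values of \<open>g\<close> at negative x are
  multiplied by \<open>f x = 0\<close>. The points \<open>x = t\<close>, where the intervals
  overlap, and \<open>x = p t\<close>, where \<open>kern\<close> is cut off, are null.\<close>

lemma kern_integral_split:
  fixes f :: "real \<Rightarrow> real"
  assumes t: "0 \<le> t" "t \<le> 1"
    and supp: "\<And>x. x < 0 \<or> x > 1 \<Longrightarrow> f x = 0"
    and [measurable]: "f \<in> borel_measurable borel"
    and int: "integrable lborel (\<lambda>x. f x * kern x t)"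
  shows "set_integrable lborel {p t..t} (\<lambda>x. g x t * f x)"
    and "set_integrable lborel {t..1} (\<lambda>x. (g x t - 1) * f x)"
    and "(LINT x|lborel. f x * kern x t) = 2 * (LINT x:{p t..t}|lborel. g x t * f x)
             + (LINT x:{t..1}|lborel. (g x t - 1) * f x)"
proof -
  note pt = p_le[OF t(1)]
  have ne: "AE x in lborel. x \<noteq> t \<and> x \<noteq> p t"
    using AE_lborel_singleton[of t] AE_lborel_singleton[of "p t"] by eventually_elim simp
  have lo: "AE x in lborel. (1/2) * (indicator {..t} x *\<^sub>R (f x * kern x t)) = indicator {p t..t} x *\<^sub>R (g x t * f x)"
    using ne
  proof eventually_elim
    case (elim x)
    then show ?case
      using supp[of x] t by (cases "x < 0 \<or> x > 1") (auto simp: kern_def split: split_indicator)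
  qed
  have hi: "AE x in lborel. indicator {t..} x *\<^sub>R (f x * kern x t) = indicator {t..1} x *\<^sub>R ((g x t - 1) * f x)"
    using ne
  proof eventually_elim
    case (elim x)
    then show ?case
      using supp[of x] t pt by (cases "x < 0 \<or> x > 1") (auto simp: kern_def split: split_indicator)
  qed
  have intlo: "integrable lborel (\<lambda>x. (1/2) * (indicator {..t} x *\<^sub>R (f x * kern x t)))"
    and inthi: "integrable lborel (\<lambda>x. indicator {t..} x *\<^sub>R (f x * kern x t))"
    by (rule integrable_mult_right integrable_mult_indicator[OF _ int] | simp)+
  show 1: "set_integrable lborel {p t..t} (\<lambda>x. g x t * f x)"
    unfolding set_integrable_def by (rule integrable_cong_AE_imp[OF intlo _ lo]) measurable
  show 2: "set_integrable lborel {t..1} (\<lambda>x. (g x t - 1) * f x)"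
    unfolding set_integrable_def by (rule integrable_cong_AE_imp[OF inthi _ hi]) measurable
  have "(LINT x|lborel. f x * kern x t) = (LINT x|lborel. 2 * (indicator {p t..t} x *\<^sub>R (g x t * f x))
      + indicator {t..1} x *\<^sub>R ((g x t - 1) * f x))"
  proof (rule integral_cong_AE)
    show "AE x in lborel. f x * kern x t = 2 * (indicator {p t..t} x *\<^sub>R (g x t * f x))
        + indicator {t..1} x *\<^sub>R ((g x t - 1) * f x)"
      using lo hi ne
    proof eventually_elim
      case (elim x)
      show ?case
        unfolding elim(1)[symmetric] elim(2)[symmetric]
        using elim(3) by (auto split: split_indicator)
    qed
  qed measurable
  also have "\<dots> = 2 * (LINT x:{p t..t}|lborel. g x t * f x) + (LINT x:{t..1}|lborel. (g x t - 1) * f x)"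
    using 1 2 unfolding set_integrable_def set_lebesgue_integral_def
    by (subst Bochner_Integration.integral_add) auto
  finally show "(LINT x|lborel. f x * kern x t) = 2 * (LINT x:{p t..t}|lborel. g x t * f x)
             + (LINT x:{t..1}|lborel. (g x t - 1) * f x)" .
qed

theorem theorem4p3:
  fixes M :: "'a measure" and X :: "'a \<Rightarrow> real"
  assumes "prob_space M"
    and "X \<in> borel_measurable M"
    and "fixed_point_law (distr M borel X)"
  shows "\<exists>f :: real \<Rightarrow> real.
    (\<forall>t. 0 \<le> f t) \<and>
    distributed M lborel X (\<lambda>t. ennreal (f t)) \<and>
    (\<forall>t. t < 0 \<or> t > 1 \<longrightarrow> f t = 0) \<and>
    (\<forall>t\<in>{0..1}.
       set_integrable lborel {p t..t} (\<lambda>x. g x t * f x) \<and>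
       set_integrable lborel {t..1} (\<lambda>x. (g x t - 1) * f x) \<and>
       f t = 2 * (LINT x:{p t..t}|lborel. g x t * f x)
             + (LINT x:{t..1}|lborel. (g x t - 1) * f x))"
proof -
  define \<mu> where "\<mu> = distr M borel X"
  have \<mu>: "fixed_point_law \<mu>" using assms(3) by (simp only: \<mu>_def)
  interpret real_distribution \<mu> using \<mu> by (simp add: fixed_point_law_def)
  define F where "F t = (\<integral>\<^sup>+x. ennreal (kern x t) \<partial>\<mu>)" for t
  have [measurable]: "F \<in> borel_measurable borel" unfolding F_def by measurable
  have dens: "\<mu> = density lborel F"
    unfolding F_def by (rule fixed_point_law_density[OF \<mu>])
  \<comment> \<open>\<open>F\<close> is one specific version of the density, so inserting the
    density into its defining integral gives an identity at every t.\<close>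
  have fixp: "F t = (\<integral>\<^sup>+x. F x * ennreal (kern x t) \<partial>lborel)" for t
  proof -
    have "F t = (\<integral>\<^sup>+x. ennreal (kern x t) \<partial>density lborel F)"
      by (simp only: F_def[of t] dens[symmetric])
    then show ?thesis by (simp add: nn_integral_density)
  qed
  have fin: "F t < \<infinity>" for t
    by (rule kern_fixed_point_finite[OF real_distribution_axioms F_def fixp])
  define f where "f t = enn2real (F t)" for t
  have [measurable]: "f \<in> borel_measurable borel" unfolding f_def by measurable
  have f_nonneg: "0 \<le> f t" for t by (simp add: f_def)
  have Ff: "F t = ennreal (f t)" for t using fin[of t] by (simp add: f_def)
  have supp: "f t = 0" if "t < 0 \<or> t > 1" for t
    using that by (auto simp: f_def F_def kern_def)
  have nn: "(\<integral>\<^sup>+x. ennreal (f x * kern x t) \<partial>lborel) = ennreal (f t)" for t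
    using fixp[of t] unfolding Ff by (simp add: ennreal_mult f_nonneg kern_nonneg)
  \<comment> \<open>Pointwise finiteness of \<open>F\<close> enters here: by \<open>nn\<close> the
    integral of this nonnegative function is the real number \<open>f t\<close>.\<close>
  have int: "integrable lborel (\<lambda>x. f x * kern x t)" for t
    by (rule integrableI_nonneg) (auto simp: nn f_nonneg kern_nonneg)
  have eq: "f t = (LINT x|lborel. f x * kern x t)" for t
    by (subst integral_eq_nn_integral) (auto simp: nn f_nonneg kern_nonneg)
  have "distr M lborel X = \<mu>"
    unfolding \<mu>_def by (rule distr_cong) auto
  with dens assms(2) have dist: "distributed M lborel X (\<lambda>t. ennreal (f t))"
    unfolding distributed_def by (simp flip: Ff)
  show ?thesis
  proof (intro exI[of _ f] conjI allI ballI impI)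
    fix t :: real assume t: "t \<in> {0..1}"
    note split = kern_integral_split[OF _ _ supp \<open>f \<in> borel_measurable borel\<close> int, of t]
    show "set_integrable lborel {p t..t} (\<lambda>x. g x t * f x)"
      "set_integrable lborel {t..1} (\<lambda>x. (g x t - 1) * f x)"
      "f t = 2 * (LINT x:{p t..t}|lborel. g x t * f x) + (LINT x:{t..1}|lborel. (g x t - 1) * f x)"
      using split t by (auto simp flip: eq)
  qed (use f_nonneg dist supp in auto)
qed

end
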